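(* Let $\bar x$ be feasible for the mathematical program with equilibrium constraints (MPEC) $$\min_{x\in\mathbb{R}^n} f(x)\ \text{ s.t. }\ g(x)\le 0,\ h(x)=0,\ G_i(x)\ge 0,\ H_i(x)\ge 0,\ G_i(x)H_i(x)=0,\ i=1,\ldots,q.$$ Assume that $\bar x$ is extended M-stationary for this problem and that there exists some MPEC working set. Then $\bar x$ is strongly M-stationary.
   Context: Data: $f:\mathbb{R}^n\to\mathbb{R}$, $g:\mathbb{R}^n\to\mathbb{R}^l$, $h:\mathbb{R}^n\to\mathbb{R}^p$, $G,H:\mathbb{R}^n\to\mathbb{R}^q$ are continuously differentiable and twice Fréchet differentiable at $\bar x$. Let $Q_{\rm EC}=\{(a,b)\in\mathbb{R}^2 : a\le 0,\ b\le 0,\ ab=0\}$. Index sets: $\bar I_g=\{i : g_i(\bar x)=0\}$, $\bar I^{+0}=\{i : G_i(\bar x)>0=H_i(\bar x)\}$, $\bar I^{0+}=\{i : G_i(\bar x)=0<H_i(\bar x)\}$, $\bar I^{00}=\{i : G_i(\bar x)=0=H_i(\bar x)\}$. $T_{\rm lin}(\bar x)$ is the set of $u\in\mathbb{R}^n$ with $\nabla g_i(\bar x)u\le 0$ ($i\in\bar I_g$), $\nabla h_i(\bar x)u=0$ ($i=1,\dots,p$), $\nabla G_i(\bar x)u=0$ ($i\in\bar I^{0+}$), $\nabla H_i(\bar x)u=0$ ($i\in\bar I^{+0}$), $-(\nabla G_i(\bar x)u,\nabla H_i(\bar x)u)\in Q_{\rm EC}$ ($i\in\bar I^{00}$). Critical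 cone: $\mathcal{C}(\bar x)=\{u\in T_{\rm lin}(\bar x) : \nabla f(\bar x)u\le 0\}$. For $u\in T_{\rm lin}(\bar x)$: $I_g(u)=\{i\in\bar I_g : \nabla g_i(\bar x)u=0\}$, $I^{+0}(u)=\{i\in\bar I^{00} : \nabla G_i(\bar x)u>0=\nabla H_i(\bar x)u\}$, $I^{0+}(u)=\{i\in\bar I^{00} : \nabla G_i(\bar x)u=0<\nabla H_i(\bar x)u\}$, $I^{00}(u)=\{i\in\bar I^{00} : \nabla G_i(\bar x)u=0=\nabla H_i(\bar x)u\}$. $\mathcal{L}(x,\lambda_0,\lambda)=\lambda_0f(x)+{\lambda^g}^Tg(x)+{\lambda^h}^Th(x)-{\lambda^G}^TG(x)-{\lambda^H}^TH(x)$ for $\lambda=(\lambda^g,\lambda^h,\lambda^G,\lambda^H)\in\mathbb{R}^l\times\mathbb{R}^p\times\mathbb{R}^q\times\mathbb{R}^q$. $\Lambda^1(\bar x;u)$ is the set of $\lambda=(\lambda^g,\lambda^h,\lambda^G,\lambda^H)$ with $\nabla_x\mathcal{L}(\bar x,1,\lambda)=0$; $\lambda^g_i\ge 0$ and $\lambda^g_ig_i(\bar x)=0$ for $i=1,\dots,l$; $\lambda^g_i=0$ for $i\in\bar I_g\setminus I_g(u)$; $\lambda^H_i=0$ for $i\in\bar I^{0+}\cup I^{0+}(u)$; $\lambda^G_i=0$ for $i\in\bar I^{+0}\cup I^{+0}(u)$; and, for $i\in I^{00}(u)$, either $\lambda^G_i>0,\ \lambda^H_i>0$ or $\lambda^G_i\lambda^H_i=0$.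 Set $\Lambda^1(\bar x)=\Lambda^1(\bar x;0)$. $\bar x$ is extended M-stationary if $\Lambda^1(\bar x;u)\neq\emptyset$ for all $u\in\mathcal{C}(\bar x)$. Let $r(\bar x)$ be the rank of the family of gradients $\{\nabla g_i(\bar x) : i\in\bar I_g\}\cup\{\nabla h_i(\bar x) : i=1,\dots,p\}\cup\{\nabla G_i(\bar x) : i\in\bar I^{0+}\cup\bar I^{00}\}\cup\{\nabla H_i(\bar x) : i\in\bar I^{+0}\cup\bar I^{00}\}$. A triple $(J_g,J_G,J_H)$ with $J_g\subset\bar I_g$, $J_G\subset\bar I^{0+}\cup\bar I^{00}$, $J_H\subset\bar I^{+0}\cup\bar I^{00}$ is an MPEC working set if $J_G\cup J_H=\{1,\dots,q\}$, $|J_g|+p+|J_G|+|J_H|=r(\bar x)$, and the family $\{\nabla g_i(\bar x) : i\in J_g\}\cup\{\nabla h_i(\bar x) : i=1,\dots,p\}\cup\{\nabla G_i(\bar x) : i\in J_G\}\cup\{\nabla H_i(\bar x) : i\in J_H\}$ is linearly independent. $\bar x$ is strongly M-stationary if there are an MPEC working set $(J_g,J_G,J_H)$ and a multiplier $\lambda\in\Lambda^1(\bar x)$ with $\lambda^g_i=0$ for $i\in\{1,\dots,l\}\setminus J_g$, $\lambda^G_i=0$ for $i\in\{1,\dots,q\}\setminus J_G$, $\lambda^H_i=0$ for $i\in\{1,\dots,q\}\setminus J_H$, and $\lambda^G_i\ge 0,\ \lambda^H_i\ge 0$ for $i\in J_G\cap J_H$. *)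

theory Defs
  imports "HOL-Analysis.Analysis"
begin

definition gradient :: "(real^'n \<Rightarrow> real) \<Rightarrow> real^'n \<Rightarrow> real^'n" where
  "gradient \<phi> x = (THE D. GDERIV \<phi> x :> D)"

text \<open>Identifying the derivative with the gradient, a differentiable function is twice
  Frechet differentiable at a point iff its gradient map is Frechet differentiable there.\<close>

definition C1_twice_differentiable_at :: "(real^'n \<Rightarrow> real) \<Rightarrow> real^'n \<Rightarrow> bool" where
  "C1_twice_differentiable_at \<phi> x \<longleftrightarrow>
     (\<forall>y. \<phi> differentiable (at y)) \<and> continuous_on UNIV (gradient \<phi>) \<and>
     gradient \<phi> differentiable (at x)"

text \<open>The vector-valued maps are given by their component functions. The components are
  numbered from 1, and the values at indices outside \<open>{1..dim_g P}\<close>, \<open>{1..dim_h P}\<close>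
  and \<open>{1..dim_GH P}\<close> are never used. In this way the numbers of constraints may be 0.\<close>

record ('n::finite) mpec =
  obj :: "real^'n \<Rightarrow> real"
  dim_g :: nat
  con_g :: "nat \<Rightarrow> real^'n \<Rightarrow> real"
  dim_h :: nat
  con_h :: "nat \<Rightarrow> real^'n \<Rightarrow> real"
  dim_GH :: nat
  con_G :: "nat \<Rightarrow> real^'n \<Rightarrow> real"
  con_H :: "nat \<Rightarrow> real^'n \<Rightarrow> real"

definition mpec_smooth :: "'n::finite mpec \<Rightarrow> real^'n \<Rightarrow> bool" where
  "mpec_smooth P x \<longleftrightarrow>
     C1_twice_differentiable_at (obj P) x \<and>
     (\<forall>i\<in>{1..dim_g P}. C1_twice_differentiable_at (con_g P i) x) \<and>
     (\<forall>i\<in>{1..dim_h P}. C1_twice_differentiable_at (con_h P i) x) \<and>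
     (\<forall>i\<in>{1..dim_GH P}. C1_twice_differentiable_at (con_G P i) x \<and>
                         C1_twice_differentiable_at (con_H P i) x)"

definition feasible :: "'n::finite mpec \<Rightarrow> real^'n \<Rightarrow> bool" where
  "feasible P x \<longleftrightarrow>
     (\<forall>i\<in>{1..dim_g P}. con_g P i x \<le> 0) \<and>
     (\<forall>i\<in>{1..dim_h P}. con_h P i x = 0) \<and>
     (\<forall>i\<in>{1..dim_GH P}. con_G P i x \<ge> 0 \<and> con_H P i x \<ge> 0 \<and> con_G P i x * con_H P i x = 0)"

text \<open>In the names of index sets, \<open>p\<close> stands for the superscript \<open>+\<close> and \<open>z\<close> for the
  superscript \<open>0\<close>; the first letter refers to \<open>G\<close>, the second one to \<open>H\<close>.\<close>

definition I_g :: "'n::finite mpec \<Rightarrow> real^'n \<Rightarrow> nat set" where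
  "I_g P x = {i \<in> {1..dim_g P}. con_g P i x = 0}"

definition I_pz :: "'n::finite mpec \<Rightarrow> real^'n \<Rightarrow> nat set" where
  "I_pz P x = {i \<in> {1..dim_GH P}. con_G P i x > 0 \<and> con_H P i x = 0}"

definition I_zp :: "'n::finite mpec \<Rightarrow> real^'n \<Rightarrow> nat set" where
  "I_zp P x = {i \<in> {1..dim_GH P}. con_G P i x = 0 \<and> con_H P i x > 0}"

definition I_zz :: "'n::finite mpec \<Rightarrow> real^'n \<Rightarrow> nat set" where
  "I_zz P x = {i \<in> {1..dim_GH P}. con_G P i x = 0 \<and> con_H P i x = 0}"

definition Q_EC :: "(real \<times> real) set" where
  "Q_EC = {(a, b). a \<le> 0 \<and> b \<le> 0 \<and> a * b = 0}"

definition T_lin :: "'n::finite mpec \<Rightarrow> real^'n \<Rightarrow> (real^'n) set" where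
  "T_lin P x = {u.
     (\<forall>i\<in>I_g P x. gradient (con_g P i) x \<bullet> u \<le> 0) \<and>
     (\<forall>i\<in>{1..dim_h P}. gradient (con_h P i) x \<bullet> u = 0) \<and>
     (\<forall>i\<in>I_zp P x. gradient (con_G P i) x \<bullet> u = 0) \<and>
     (\<forall>i\<in>I_pz P x. gradient (con_H P i) x \<bullet> u = 0) \<and>
     (\<forall>i\<in>I_zz P x. - (gradient (con_G P i) x \<bullet> u, gradient (con_H P i) x \<bullet> u) \<in> Q_EC)}"

definition critical_cone :: "'n::finite mpec \<Rightarrow> real^'n \<Rightarrow> (real^'n) set" where
  "critical_cone P x = {u \<in> T_lin P x. gradient (obj P) x \<bullet> u \<le> 0}"

definition I_g_dir :: "'n::finite mpec \<Rightarrow> real^'n \<Rightarrow> real^'n \<Rightarrow> nat set" where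
  "I_g_dir P x u = {i \<in> I_g P x. gradient (con_g P i) x \<bullet> u = 0}"

definition I_pz_dir :: "'n::finite mpec \<Rightarrow> real^'n \<Rightarrow> real^'n \<Rightarrow> nat set" where
  "I_pz_dir P x u =
     {i \<in> I_zz P x. gradient (con_G P i) x \<bullet> u > 0 \<and> gradient (con_H P i) x \<bullet> u = 0}"

definition I_zp_dir :: "'n::finite mpec \<Rightarrow> real^'n \<Rightarrow> real^'n \<Rightarrow> nat set" where
  "I_zp_dir P x u =
     {i \<in> I_zz P x. gradient (con_G P i) x \<bullet> u = 0 \<and> gradient (con_H P i) x \<bullet> u > 0}"

definition I_zz_dir :: "'n::finite mpec \<Rightarrow> real^'n \<Rightarrow> real^'n \<Rightarrow> nat set" where
  "I_zz_dir P x u =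
     {i \<in> I_zz P x. gradient (con_G P i) x \<bullet> u = 0 \<and> gradient (con_H P i) x \<bullet> u = 0}"

type_synonym multiplier = "(nat \<Rightarrow> real) \<times> (nat \<Rightarrow> real) \<times> (nat \<Rightarrow> real) \<times> (nat \<Rightarrow> real)"

text \<open>The space of vectors with \<open>m\<close> components, as functions vanishing outside \<open>{1..m}\<close>.\<close>

definition vecs :: "nat \<Rightarrow> (nat \<Rightarrow> real) set" where
  "vecs m = {v. \<forall>i. i \<notin> {1..m} \<longrightarrow> v i = 0}"

definition Lagrangian :: "'n::finite mpec \<Rightarrow> real^'n \<Rightarrow> real \<Rightarrow> multiplier \<Rightarrow> real" where
  "Lagrangian P x \<mu>0 = (\<lambda>(\<mu>g, \<mu>h, \<mu>G, \<mu>H).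
     \<mu>0 * obj P x + (\<Sum>i\<in>{1..dim_g P}. \<mu>g i * con_g P i x) + (\<Sum>i\<in>{1..dim_h P}. \<mu>h i * con_h P i x)
     - (\<Sum>i\<in>{1..dim_GH P}. \<mu>G i * con_G P i x) - (\<Sum>i\<in>{1..dim_GH P}. \<mu>H i * con_H P i x))"

definition Lambda1_dir :: "'n::finite mpec \<Rightarrow> real^'n \<Rightarrow> real^'n \<Rightarrow> multiplier set" where
  "Lambda1_dir P x u = {(\<mu>g, \<mu>h, \<mu>G, \<mu>H).
     \<mu>g \<in> vecs (dim_g P) \<and> \<mu>h \<in> vecs (dim_h P) \<and> \<mu>G \<in> vecs (dim_GH P) \<and> \<mu>H \<in> vecs (dim_GH P) \<and>
     gradient (\<lambda>y. Lagrangian P y 1 (\<mu>g, \<mu>h, \<mu>G, \<mu>H)) x = 0 \<and>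
     (\<forall>i\<in>{1..dim_g P}. \<mu>g i \<ge> 0 \<and> \<mu>g i * con_g P i x = 0) \<and>
     (\<forall>i\<in>I_g P x - I_g_dir P x u. \<mu>g i = 0) \<and>
     (\<forall>i\<in>I_zp P x \<union> I_zp_dir P x u. \<mu>H i = 0) \<and>
     (\<forall>i\<in>I_pz P x \<union> I_pz_dir P x u. \<mu>G i = 0) \<and>
     (\<forall>i\<in>I_zz_dir P x u. (\<mu>G i > 0 \<and> \<mu>H i > 0) \<or> \<mu>G i * \<mu>H i = 0)}"

definition Lambda1 :: "'n::finite mpec \<Rightarrow> real^'n \<Rightarrow> multiplier set" where
  "Lambda1 P x = Lambda1_dir P x 0"

definition extended_M_stationary :: "'n::finite mpec \<Rightarrow> real^'n \<Rightarrow> bool" where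
  "extended_M_stationary P x \<longleftrightarrow> (\<forall>u\<in>critical_cone P x. Lambda1_dir P x u \<noteq> {})"

text \<open>Gradients belonging to different constraints may coincide as vectors, so they are
  treated as a family indexed by constraint labels and not as a set.\<close>

datatype label = Lab_g nat | Lab_h nat | Lab_G nat | Lab_H nat

fun con_gradient :: "'n::finite mpec \<Rightarrow> real^'n \<Rightarrow> label \<Rightarrow> real^'n" where
  "con_gradient P x (Lab_g i) = gradient (con_g P i) x"
| "con_gradient P x (Lab_h i) = gradient (con_h P i) x"
| "con_gradient P x (Lab_G i) = gradient (con_G P i) x"
| "con_gradient P x (Lab_H i) = gradient (con_H P i) x"

definition labels :: "'n::finite mpec \<Rightarrow> nat set \<Rightarrow> nat set \<Rightarrow> nat set \<Rightarrow> label set" where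
  "labels P Jg JG JH = Lab_g ` Jg \<union> Lab_h ` {1..dim_h P} \<union> Lab_G ` JG \<union> Lab_H ` JH"

definition independent_family :: "('i \<Rightarrow> 'a::real_vector) \<Rightarrow> 'i set \<Rightarrow> bool" where
  "independent_family v J \<longleftrightarrow> inj_on v J \<and> independent (v ` J)"

definition mpec_rank :: "'n::finite mpec \<Rightarrow> real^'n \<Rightarrow> nat" where
  "mpec_rank P x =
     dim (con_gradient P x ` labels P (I_g P x) (I_zp P x \<union> I_zz P x) (I_pz P x \<union> I_zz P x))"

definition mpec_working_set ::
  "'n::finite mpec \<Rightarrow> real^'n \<Rightarrow> nat set \<Rightarrow> nat set \<Rightarrow> nat set \<Rightarrow> bool" where
  "mpec_working_set P x Jg JG JH \<longleftrightarrow>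
     Jg \<subseteq> I_g P x \<and> JG \<subseteq> I_zp P x \<union> I_zz P x \<and> JH \<subseteq> I_pz P x \<union> I_zz P x \<and>
     JG \<union> JH = {1..dim_GH P} \<and>
     card Jg + dim_h P + card JG + card JH = mpec_rank P x \<and>
     independent_family (con_gradient P x) (labels P Jg JG JH)"

definition strongly_M_stationary :: "'n::finite mpec \<Rightarrow> real^'n \<Rightarrow> bool" where
  "strongly_M_stationary P x \<longleftrightarrow>
     (\<exists>Jg JG JH \<mu>g \<mu>h \<mu>G \<mu>H.
        mpec_working_set P x Jg JG JH \<and> (\<mu>g, \<mu>h, \<mu>G, \<mu>H) \<in> Lambda1 P x \<and>
        (\<forall>i\<in>{1..dim_g P} - Jg. \<mu>g i = 0) \<and>
        (\<forall>i\<in>{1..dim_GH P} - JG. \<mu>G i = 0) \<and>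
        (\<forall>i\<in>{1..dim_GH P} - JH. \<mu>H i = 0) \<and>
        (\<forall>i\<in>JG \<inter> JH. \<mu>G i \<ge> 0 \<and> \<mu>H i \<ge> 0))"

end

(* Extended M-stationarity says that the objective gradient is nonnegative on the linearised
   tangent cone: pairing the stationarity equation of a multiplier for a critical direction u with
   u annihilates every constraint term. Now perturb the right-hand sides of the linearised problem
   so that the given working set stays active at 0, all other constraints become slack there, and
   at every point the active gradients are linearly independent. The perturbed problem is feasible
   and, its directions of recession lying in the tangent cone, it attains its minimum at a vertex.
   The active constraints at that vertex form an MPEC working set, and by nondegeneracy the
   multipliers there have the signs of strong M-stationarity; the right-hand sides do not enter
   the multiplier conditions, so these hold for the unperturbed problem as well. *)

theory Submission
  imports Defs
begin

section \<open>Independence and spans of indexed families\<close>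

lemma independent_family_iff:
  "independent_family v J \<longleftrightarrow> (\<forall>j\<in>J. v j \<notin> span (v ` (J - {j})))"
proof -
  have "inj_on v J" if a: "\<forall>j\<in>J. v j \<notin> span (v ` (J - {j}))"
  proof (rule inj_onI, rule ccontr)
    fix i j assume ij: "i \<in> J" "j \<in> J" "v i = v j" "i \<noteq> j"
    then have "v i \<in> v ` (J - {i})" by force
    then show False using bspec[OF a ij(1)] span_base[of "v i" "v ` (J - {i})"] by simp
  qed
  moreover have "independent (v ` J) \<longleftrightarrow> (\<forall>j\<in>J. v j \<notin> span (v ` (J - {j})))" if "inj_on v J"
  proof -
    have "v ` J - {v j} = v ` (J - {j})" if "j \<in> J" for j
      using inj_on_image_set_diff[of v J J "{j}"] \<open>inj_on v J\<close> that by simp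
    then show ?thesis unfolding dependent_def by simp
  qed
  ultimately show ?thesis unfolding independent_family_def by argo
qed

lemma independent_family_insert:
  assumes "independent_family v J" "v i \<notin> span (v ` J)"
  shows "independent_family v (insert i J)"
proof -
  have "v i \<notin> v ` J" using assms(2) by (rule contrapos_nn) (rule span_base)
  then have "inj_on v (insert i J)" "independent (insert (v i) (v ` J))"
    using assms independent_insertI[of "v i" "v ` J"] unfolding independent_family_def
    by (auto simp: inj_on_insert)
  then show ?thesis unfolding independent_family_def by simp
qed

text \<open>Each vector is recovered from its multiple by the inverse factor. The gradients of
  \<open>G\<close> and \<open>H\<close> can therefore be negated later without changing rank or
  independence.\<close>

lemma span_image_scaleR:
  assumes "\<And>i. i \<in> A \<Longrightarrow> s i \<noteq> (0::real)"
  shows "span ((\<lambda>i. s i *\<^sub>R v i) ` A) = span (v ` A)"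
proof (rule antisym; rule span_minimal)
  show "(\<lambda>i. s i *\<^sub>R v i) ` A \<subseteq> span (v ` A)"
    by (auto intro: span_scale span_base)
  show "v ` A \<subseteq> span ((\<lambda>i. s i *\<^sub>R v i) ` A)"
  proof
    fix x assume "x \<in> v ` A"
    then obtain i where i: "i \<in> A" "x = v i" by auto
    have "inverse (s i) *\<^sub>R (s i *\<^sub>R v i) \<in> span ((\<lambda>i. s i *\<^sub>R v i) ` A)"
      using i by (intro span_scale span_base) auto
    then show "x \<in> span ((\<lambda>i. s i *\<^sub>R v i) ` A)" using i assms by simp
  qed
qed simp_all

lemma independent_family_scaleR:
  assumes "\<And>i. i \<in> A \<Longrightarrow> s i \<noteq> (0::real)"
  shows "independent_family (\<lambda>i. s i *\<^sub>R v i) A \<longleftrightarrow> independent_family v A"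
proof -
  have "s j *\<^sub>R v j \<in> span ((\<lambda>i. s i *\<^sub>R v i) ` (A - {j})) \<longleftrightarrow> v j \<in> span (v ` (A - {j}))"
    if "j \<in> A" for j
  proof -
    have "span ((\<lambda>i. s i *\<^sub>R v i) ` (A - {j})) = span (v ` (A - {j}))"
      using assms by (intro span_image_scaleR) auto
    moreover have "s j *\<^sub>R v j \<in> S \<longleftrightarrow> v j \<in> S" if "subspace S" for S
      using subspace_scale[OF that, of "v j" "s j"] assms[OF \<open>j \<in> A\<close>]
        subspace_scale[OF that, of "s j *\<^sub>R v j" "inverse (s j)"] by auto
    ultimately show ?thesis by simp
  qed
  then show ?thesis unfolding independent_family_iff by blast
qed

text \<open>The component of \<open>x\<close> orthogonal to \<open>span S\<close> is nonzero;
  rescaling it gives \<open>d\<close>. The value -1 makes \<open>d\<close> a direction that keeps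
  the constraints in \<open>S\<close> tight and moves into the interior of the constraint with
  normal \<open>x\<close>.\<close>

lemma not_in_span_separating_vector:
  fixes x :: "'a::euclidean_space"
  assumes "x \<notin> span S"
  obtains d where "\<And>y. y \<in> S \<Longrightarrow> y \<bullet> d = 0" "x \<bullet> d = - 1"
proof -
  obtain y z where yz: "y \<in> span S" "\<And>w. w \<in> span S \<Longrightarrow> orthogonal z w" "x = y + z"
    using orthogonal_subspace_decomp_exists by blast
  have "z \<noteq> 0" using yz assms by auto
  have "y \<bullet> z = 0" using yz(1,2) by (simp add: orthogonal_def inner_commute)
  then have "x \<bullet> z = z \<bullet> z" using yz(3) by (simp add: inner_add_left)
  show ?thesis
  proof
    show "y \<bullet> ((- 1 / (z \<bullet> z)) *\<^sub>R z) = 0" if "y \<in> S" for y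
      using yz(2)[OF span_base[OF that]] by (simp add: orthogonal_def inner_commute)
    show "x \<bullet> ((- 1 / (z \<bullet> z)) *\<^sub>R z) = - 1"
      using \<open>x \<bullet> z = z \<bullet> z\<close> \<open>z \<noteq> 0\<close> by simp
  qed
qed

section \<open>Generic right-hand sides\<close>

lemma inner_eq_on_span:
  assumes "x \<in> span S" "\<And>y. y \<in> S \<Longrightarrow> y \<bullet> u = y \<bullet> u'"
  shows "x \<bullet> u = x \<bullet> u'"
  using assms(1)
  by (induction rule: span_induct_alt) (auto simp: inner_add_left assms(2))

text \<open>The values on \<open>N\<close> are chosen one at a time. Independence can only be lost
  at a point where a new constraint is tight although its normal depends on those already tight
  there; each such dependence rules out at most one value, so finitely many values must be
  avoided.\<close>

lemma generic_right_hand_side: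
  fixes w :: "'i \<Rightarrow> 'a::real_inner"
  assumes "finite J" "independent_family w J" "finite N" "J \<inter> N = {}"
  obtains b where "\<And>i. i \<in> J \<Longrightarrow> b i = (0::real)" "\<And>i. i \<in> N \<Longrightarrow> b i > 0"
    "\<And>u. independent_family w {i \<in> J \<union> N. w i \<bullet> u = b i}"
proof -
  have "\<exists>b. (\<forall>i\<in>J. b i = (0::real)) \<and> (\<forall>i\<in>N. b i > 0) \<and>
      (\<forall>u. independent_family w {i \<in> J \<union> N. w i \<bullet> u = b i})"
    using assms(3,4)
  proof (induction N)
    case empty
    have "independent_family w A" if "A \<subseteq> J" for A
    proof -
      have "inj_on w J" "independent (w ` J)"
        using assms(2) unfolding independent_family_def by simp_all
      then have "inj_on w A" "independent (w ` A)"
        using inj_on_subset[of w J A] independent_mono[of "w ` J" "w ` A"] that by auto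
      then show ?thesis unfolding independent_family_def ..
    qed
    then show ?case by (intro exI[of _ "\<lambda>_. 0"]) auto
  next
    case (insert i N)
    then obtain b where b: "\<And>i. i \<in> J \<Longrightarrow> b i = (0::real)" "\<And>i. i \<in> N \<Longrightarrow> b i > 0"
      "\<And>u. independent_family w {i \<in> J \<union> N. w i \<bullet> u = b i}"
      by auto
    \<comment> \<open>\<open>X S\<close> collects the values of \<open>w i \<bullet> u\<close>
      compatible with equality on \<open>S\<close>. If \<open>w i\<close> lies in the span of these
      normals, the equalities determine that value, so \<open>X S\<close> has at most one
      element.\<close>
    define X where "X S = {w i \<bullet> u |u. \<forall>j\<in>S. w j \<bullet> u = b j}" for S
    define bad where "bad = \<Union> (X ` {S. S \<subseteq> J \<union> N \<and> w i \<in> span (w ` S)})"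
    have "finite (X S)" if "w i \<in> span (w ` S)" for S
    proof -
      have "w i \<bullet> u = w i \<bullet> u'" if "\<forall>j\<in>S. w j \<bullet> u = b j" "\<forall>j\<in>S. w j \<bullet> u' = b j" for u u'
        by (rule inner_eq_on_span[OF \<open>w i \<in> span (w ` S)\<close>]) (use that in auto)
      then have "X S \<subseteq> {x}" if "x \<in> X S" for x
        using that unfolding X_def by auto
      then show ?thesis by (metis finite.emptyI finite.insertI equals0I finite_subset)
    qed
    moreover have "finite {S. S \<subseteq> J \<union> N \<and> w i \<in> span (w ` S)}"
      using assms(1) insert.hyps(1) by auto
    ultimately have "finite bad" unfolding bad_def by auto
    then have "infinite ({0<..} - bad)"
      using infinite_Ioi by (metis Diff_infinite_finite)
    then obtain \<beta> where \<beta>: "\<beta> > 0" "\<beta> \<notin> bad"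
      by (metis DiffE finite.emptyI equals0I greaterThan_iff)
    define b' where "b' = b(i := \<beta>)"
    have i: "i \<notin> J \<union> N" using insert by auto
    have "independent_family w {k \<in> J \<union> insert i N. w k \<bullet> u = b' k}" for u
    proof -
      let ?S = "{k \<in> J \<union> N. w k \<bullet> u = b k}"
      show ?thesis
      proof (cases "w i \<bullet> u = \<beta>")
        case True
        have "{k \<in> J \<union> insert i N. w k \<bullet> u = b' k} = insert i ?S"
          using True i unfolding b'_def by auto
        moreover have "w i \<notin> span (w ` ?S)"
        proof
          assume "w i \<in> span (w ` ?S)"
          moreover have "\<beta> \<in> X ?S" using True unfolding X_def by auto
          ultimately have "\<beta> \<in> bad" unfolding bad_def by (intro UN_I[of ?S]) auto
          then show False using \<beta> by simp
        qed
        ultimately show ?thesis using b(3) independent_family_insert by metis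
      next
        case False
        then have "{k \<in> J \<union> insert i N. w k \<bullet> u = b' k} = ?S"
          using i unfolding b'_def by auto
        then show ?thesis using b(3) by metis
      qed
    qed
    moreover have "\<forall>k\<in>J. b' k = 0" "\<forall>k\<in>insert i N. b' k > 0"
      using b \<beta> i unfolding b'_def by auto
    ultimately show ?case by blast
  qed
  then show ?thesis using that by blast
qed

section \<open>Linear programs with disjunctive constraints\<close>

lemma feasible_ray_step:
  fixes w :: "'i \<Rightarrow> 'a::real_inner" and b :: "'i \<Rightarrow> real"
  assumes "finite M" "\<And>i. i \<in> M \<Longrightarrow> w i \<bullet> u \<le> b i"
    and "\<And>i. i \<in> M \<Longrightarrow> w i \<bullet> u = b i \<Longrightarrow> w i \<bullet> d \<le> 0"
  obtains t where "t > 0" "\<And>i. i \<in> M \<Longrightarrow> w i \<bullet> (u + t *\<^sub>R d) \<le> b i"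
    "(\<exists>i\<in>M. w i \<bullet> d > 0) \<Longrightarrow> \<exists>i\<in>M. w i \<bullet> d > 0 \<and> w i \<bullet> (u + t *\<^sub>R d) = b i"
proof (cases "\<exists>i\<in>M. w i \<bullet> d > 0")
  case False
  \<comment> \<open>Nothing increases along \<open>d\<close>, so every positive step is feasible; 1
    is an arbitrary choice.\<close>
  then have "w i \<bullet> (u + 1 *\<^sub>R d) \<le> b i" if "i \<in> M" for i
    using assms(2)[OF that] that by (force simp: inner_add_right)
  then show ?thesis using that[of 1] False by auto
next
  case True
  \<comment> \<open>Ratio test: \<open>q i\<close> is the step length at which constraint
    \<open>i\<close> becomes tight, and the least of these is the longest feasible step.\<close>
  define q where "q i = (b i - w i \<bullet> u) / (w i \<bullet> d)" for i
  let ?P = "{i \<in> M. w i \<bullet> d > 0}"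
  define t where "t = Min (q ` ?P)"
  have fin: "finite (q ` ?P)" "q ` ?P \<noteq> {}" using assms(1) True by auto
  have "t \<in> q ` ?P" unfolding t_def using fin by (rule Min_in)
  then obtain k where k: "k \<in> M" "w k \<bullet> d > 0" "t = q k" by auto
  \<comment> \<open>A constraint that increases along \<open>d\<close> cannot be tight at
    \<open>u\<close>, which makes the step positive.\<close>
  have "w k \<bullet> u < b k" using assms(2,3)[OF k(1)] k(2) by force
  then have "t > 0" using k unfolding q_def by simp
  have "w i \<bullet> (u + t *\<^sub>R d) \<le> b i" if "i \<in> M" for i
  proof (cases "w i \<bullet> d > 0")
    case True
    then have "t \<le> q i" unfolding t_def using fin that by auto
    then show ?thesis using True unfolding q_def by (simp add: inner_add_right field_simps)
  next
    case False
    then have "t * (w i \<bullet> d) \<le> 0" using \<open>t > 0\<close> by (simp add: mult_nonneg_nonpos)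
    then show ?thesis using assms(2)[OF that] by (simp add: inner_add_right)
  qed
  moreover have "w k \<bullet> (u + t *\<^sub>R d) = b k"
    using k unfolding q_def by (simp add: inner_add_right)
  ultimately show ?thesis using that[of t] \<open>t > 0\<close> k by blast
qed

text \<open>Each member of \<open>\<K>\<close> stands for a disjunction of equalities: a singleton
  is an equality constraint, a pair is a complementarity condition.\<close>

definition hits :: "'i set \<Rightarrow> 'i set set \<Rightarrow> bool" where
  "hits A \<K> \<longleftrightarrow> (\<forall>K\<in>\<K>. K \<inter> A \<noteq> {})"

lemma hits_mono: "hits A \<K> \<Longrightarrow> A \<subseteq> B \<Longrightarrow> hits B \<K>"
  unfolding hits_def by blast

definition active_set :: "'i set \<Rightarrow> ('i \<Rightarrow> 'a::real_inner) \<Rightarrow> ('i \<Rightarrow> real) \<Rightarrow> 'a \<Rightarrow> 'i set" where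
  "active_set M w b u = {i \<in> M. w i \<bullet> u = b i}"

text \<open>A union of polyhedra, one for each way of satisfying the disjunctions. With right-hand
  side 0 it is the cone of directions that appears in the hypothesis \<open>rec\<close>
  below.\<close>

definition disjunctive_feasible ::
  "'i set \<Rightarrow> ('i \<Rightarrow> 'a::real_inner) \<Rightarrow> ('i \<Rightarrow> real) \<Rightarrow> 'i set set \<Rightarrow> 'a set" where
  "disjunctive_feasible M w b \<K> =
     {u. (\<forall>i\<in>M. w i \<bullet> u \<le> b i) \<and> hits (active_set M w b u) \<K>}"

text \<open>Among the feasible points that cost no more than \<open>u\<close>, one with the most
  active constraints is taken. If its active normals failed to span, a direction orthogonal to them
  would lead to a further active constraint at no extra cost.\<close>

lemma vertex_not_worse:
  fixes w :: "'i \<Rightarrow> 'a::euclidean_space"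
  assumes M: "finite M"
    and rec: "\<And>d. d \<in> disjunctive_feasible M w (\<lambda>_. 0) \<K> \<Longrightarrow> c \<bullet> d \<ge> 0"
    and u: "u \<in> disjunctive_feasible M w b \<K>"
  obtains u' where "u' \<in> disjunctive_feasible M w b \<K>" "c \<bullet> u' \<le> c \<bullet> u"
    "span (w ` active_set M w b u') = span (w ` M)"
proof -
  let ?F = "disjunctive_feasible M w b \<K>" and ?A = "active_set M w b"
  let ?Q = "\<lambda>v. v \<in> ?F \<and> c \<bullet> v \<le> c \<bullet> u"
  have AM: "?A v \<subseteq> M" for v unfolding active_set_def by auto
  have "\<forall>v. ?Q v \<longrightarrow> card (?A v) < Suc (card M)"
    using AM M by (simp add: card_mono le_imp_less_Suc)
  moreover have "?Q u" using u by simp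
  ultimately obtain u' where u': "?Q u'" and max: "\<And>v. ?Q v \<Longrightarrow> card (?A v) \<le> card (?A u')"
    using ex_has_greatest_nat[of ?Q u "\<lambda>v. card (?A v)" "Suc (card M)"] by (meson less_imp_le_nat)
  \<comment> \<open>A ray that keeps the active constraints tight, does not raise the cost and
    increases some constraint stops at a newly tight one, against maximality.\<close>
  have no_step: False
    if d: "\<And>i. i \<in> ?A u' \<Longrightarrow> w i \<bullet> d = 0" "c \<bullet> d \<le> 0" and k: "k \<in> M" "w k \<bullet> d > 0" for d k
  proof -
    obtain t where t: "t > 0" "\<And>i. i \<in> M \<Longrightarrow> w i \<bullet> (u' + t *\<^sub>R d) \<le> b i"
      "\<exists>i\<in>M. w i \<bullet> d > 0 \<and> w i \<bullet> (u' + t *\<^sub>R d) = b i"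
    proof (rule feasible_ray_step[of M w u' b d])
      show "w i \<bullet> u' \<le> b i" if "i \<in> M" for i
        using u' that unfolding disjunctive_feasible_def by auto
      show "w i \<bullet> d \<le> 0" if "i \<in> M" "w i \<bullet> u' = b i" for i
        using d(1) that unfolding active_set_def by auto
    qed (use M k in blast)+
    let ?v = "u' + t *\<^sub>R d"
    obtain j where j: "j \<in> M" "w j \<bullet> d > 0" "w j \<bullet> ?v = b j" using t(3) by blast
    have sub: "?A u' \<subseteq> ?A ?v"
      using d(1) unfolding active_set_def by (auto simp: inner_add_right)
    moreover have "j \<in> ?A ?v" "j \<notin> ?A u'" using j d(1) unfolding active_set_def by force+
    ultimately have "?A u' \<subset> ?A ?v" by blast
    then have "card (?A u') < card (?A ?v)"
      using M AM by (meson finite_subset psubset_card_mono)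
    moreover have "?v \<in> ?F"
      using t(2) u' sub hits_mono unfolding disjunctive_feasible_def by blast
    moreover have "c \<bullet> ?v \<le> c \<bullet> u"
    proof -
      have "t * (c \<bullet> d) \<le> 0" using t(1) d(2) by (simp add: mult_nonneg_nonpos)
      then show ?thesis using u' by (simp add: inner_add_right)
    qed
    ultimately show False using max by fastforce
  qed
  have "w k \<in> span (w ` ?A u')" if k: "k \<in> M" for k
  proof (rule ccontr)
    assume "w k \<notin> span (w ` ?A u')"
    then obtain d0 where d0: "\<And>y. y \<in> w ` ?A u' \<Longrightarrow> y \<bullet> d0 = 0" "w k \<bullet> d0 = - 1"
      by (rule not_in_span_separating_vector) blast
    \<comment> \<open>The sign is chosen so that the cost does not increase along
      \<open>d\<close>.\<close>
    define d where "d = (if c \<bullet> d0 \<le> 0 then d0 else - d0)"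
    have d: "\<And>i. i \<in> ?A u' \<Longrightarrow> w i \<bullet> d = 0" "c \<bullet> d \<le> 0" "w k \<bullet> d \<noteq> 0"
      using d0 unfolding d_def by auto
    have nonpos: "w i \<bullet> d \<le> 0" if "i \<in> M" for i
      using no_step[OF d(1,2) that] by force
    have "?A u' \<subseteq> active_set M w (\<lambda>_. 0) d"
      using d(1) AM unfolding active_set_def by blast
    moreover have "hits (?A u') \<K>" using u' unfolding disjunctive_feasible_def by simp
    ultimately have "d \<in> disjunctive_feasible M w (\<lambda>_. 0) \<K>"
      using nonpos hits_mono unfolding disjunctive_feasible_def by blast
    \<comment> \<open>By \<open>rec\<close> the cost cannot decrease along \<open>d\<close>, so it
      is constant there. Hence \<open>- d\<close> is admissible in \<open>no_step\<close> as well,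
      and constraint \<open>k\<close> increases along it.\<close>
    then have "c \<bullet> d = 0" using rec d(2) by force
    moreover have "w k \<bullet> d < 0" using nonpos[OF k] d(3) by simp
    ultimately show False using no_step[of "- d" k] d(1) k by simp
  qed
  then have "span (w ` ?A u') = span (w ` M)"
    by (intro antisym span_minimal span_mono) (use AM in auto)
  then show ?thesis using that u' by blast
qed

text \<open>Since \<open>c\<close> lies in the span of the active normals at a vertex, the cost of a
  vertex depends only on its active set. So vertices have finitely many costs, and by
  \<open>vertex_not_worse\<close> the least of them bounds the cost of every feasible point.
  Vertices need not be unique for a given active set, as the normals may fail to span the whole
  space.\<close>

lemma best_vertex_exists:
  fixes w :: "'i \<Rightarrow> 'a::euclidean_space"
  assumes M: "finite M"
    and rec: "\<And>d. d \<in> disjunctive_feasible M w (\<lambda>_. 0) \<K> \<Longrightarrow> c \<bullet> d \<ge> 0"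
    and c: "c \<in> span (w ` M)"
    and ne: "u0 \<in> disjunctive_feasible M w b \<K>"
  obtains u where "u \<in> disjunctive_feasible M w b \<K>"
    "span (w ` active_set M w b u) = span (w ` M)"
    "\<And>v. v \<in> disjunctive_feasible M w b \<K> \<Longrightarrow> c \<bullet> u \<le> c \<bullet> v"
proof -
  let ?F = "disjunctive_feasible M w b \<K>" and ?A = "active_set M w b"
  define V where "V = {u \<in> ?F. span (w ` ?A u) = span (w ` M)}"
  have eq: "c \<bullet> u = c \<bullet> u'" if "u \<in> V" "u' \<in> V" "?A u = ?A u'" for u u'
  proof (rule inner_eq_on_span)
    show "c \<in> span (w ` ?A u)" using c that(1) unfolding V_def by simp
    fix y assume "y \<in> w ` ?A u"
    then obtain i where i: "i \<in> ?A u" "y = w i" by blast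
    moreover have "i \<in> ?A u'" using i that(3) by simp
    ultimately show "y \<bullet> u = y \<bullet> u'" unfolding active_set_def by simp
  qed
  \<comment> \<open>Every vertex cost is the cost of the representative chosen for its active
    set.\<close>
  have "(\<lambda>u. c \<bullet> u) ` V \<subseteq> (\<lambda>S. c \<bullet> (SOME u. u \<in> V \<and> ?A u = S)) ` Pow M"
  proof
    fix x assume "x \<in> (\<lambda>u. c \<bullet> u) ` V"
    then obtain u where u: "u \<in> V" "x = c \<bullet> u" by auto
    let ?u = "SOME u'. u' \<in> V \<and> ?A u' = ?A u"
    have "?u \<in> V \<and> ?A ?u = ?A u" by (rule someI[of _ u]) (use u in simp)
    then have "x = c \<bullet> ?u" using eq u by metis
    moreover have "?A u \<in> Pow M" unfolding active_set_def by auto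
    ultimately show "x \<in> (\<lambda>S. c \<bullet> (SOME u. u \<in> V \<and> ?A u = S)) ` Pow M" by blast
  qed
  then have "finite ((\<lambda>u. c \<bullet> u) ` V)" using M finite_subset by blast
  moreover have "V \<noteq> {}"
  proof -
    obtain v where "v \<in> V"
      using vertex_not_worse[of M w \<K> c u0 b thesis] M rec ne unfolding V_def by simp
    then show ?thesis by blast
  qed
  ultimately have "Min ((\<lambda>u. c \<bullet> u) ` V) \<in> (\<lambda>u. c \<bullet> u) ` V" by (intro Min_in) auto
  then obtain u where u: "u \<in> V" "c \<bullet> u = Min ((\<lambda>u. c \<bullet> u) ` V)" by auto
  then have min: "c \<bullet> u \<le> c \<bullet> v" if "v \<in> V" for v
    using \<open>finite ((\<lambda>u. c \<bullet> u) ` V)\<close> that by simp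
  have "c \<bullet> u \<le> c \<bullet> v" if v: "v \<in> ?F" for v
  proof -
    obtain v' where "v' \<in> V" "c \<bullet> v' \<le> c \<bullet> v"
      using vertex_not_worse[of M w \<K> c v b thesis] M rec v unfolding V_def by simp
    then show ?thesis using min by fastforce
  qed
  then show ?thesis using that u(1) unfolding V_def by blast
qed

lemma independent_family_span_coefficients:
  assumes "finite A" "independent_family w A" "x \<in> span (w ` A)"
  obtains \<mu> where "x = (\<Sum>i\<in>A. \<mu> i *\<^sub>R w i)"
proof -
  obtain \<nu> where "x = (\<Sum>y\<in>w ` A. \<nu> y *\<^sub>R y)"
    using assms span_finite[of "w ` A"] by auto
  then have "x = (\<Sum>i\<in>A. \<nu> (w i) *\<^sub>R w i)"
    using assms(2) unfolding independent_family_def by (simp add: sum.reindex)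
  then show ?thesis by (rule that)
qed

text \<open>The right-hand side \<open>b\<close> lives only inside the proof, where it removes
  degeneracy. At the optimum the active normals are independent, so one constraint can be relaxed
  while the others stay tight; this fixes the sign of its multiplier whenever the remaining
  constraints still satisfy the disjunctions.\<close>

theorem nondegenerate_optimal_basis:
  fixes w :: "'i \<Rightarrow> 'a::euclidean_space"
  assumes M: "finite M"
    and rec: "\<And>d. d \<in> disjunctive_feasible M w (\<lambda>_. 0) \<K> \<Longrightarrow> c \<bullet> d \<ge> 0"
    and J: "J \<subseteq> M" "independent_family w J" "hits J \<K>"
  obtains A \<mu> where "A \<subseteq> M" "independent_family w A" "hits A \<K>"
    "span (w ` A) = span (w ` M)" "c + (\<Sum>i\<in>A. \<mu> i *\<^sub>R w i) = 0"
    "\<And>j. j \<in> A \<Longrightarrow> hits (A - {j}) \<K> \<Longrightarrow> \<mu> j \<ge> 0"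
proof -
  \<comment> \<open>Zero on \<open>J\<close> and positive elsewhere: this keeps the origin feasible,
    with \<open>J\<close> active there.\<close>
  obtain b where b: "\<And>i. i \<in> J \<Longrightarrow> b i = (0::real)" "\<And>i. i \<in> M - J \<Longrightarrow> b i > 0"
    "\<And>u. independent_family w {i \<in> J \<union> (M - J). w i \<bullet> u = b i}"
  proof (rule generic_right_hand_side[of J w "M - J"])
    show "finite J" using J(1) M finite_subset by blast
  qed (use M J(2) in auto)
  have gen: "independent_family w (active_set M w b u)" for u
    using b(3)[of u] J(1) unfolding active_set_def by (simp add: Un_absorb1)
  \<comment> \<open>Otherwise some direction annihilates all normals and lowers the cost,
    contradicting \<open>rec\<close>.\<close>
  have c: "c \<in> span (w ` M)"
  proof (rule ccontr)
    assume "c \<notin> span (w ` M)"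
    then obtain d where d: "\<And>y. y \<in> w ` M \<Longrightarrow> y \<bullet> d = 0" "c \<bullet> d = - 1"
      by (rule not_in_span_separating_vector) blast
    have "active_set M w (\<lambda>_. 0) d = M" using d(1) unfolding active_set_def by auto
    moreover have "hits M \<K>" using J hits_mono by blast
    ultimately have "d \<in> disjunctive_feasible M w (\<lambda>_. 0) \<K>"
      using d(1) unfolding disjunctive_feasible_def by auto
    then show False using rec d(2) by force
  qed
  have "0 \<in> disjunctive_feasible M w b \<K>"
  proof -
    have "J \<subseteq> active_set M w b 0" using b(1) J(1) unfolding active_set_def by auto
    then have "hits (active_set M w b 0) \<K>" using J(3) hits_mono by blast
    moreover have "b i \<ge> 0" if "i \<in> M" for i using b(1,2)[of i] that by force
    ultimately show ?thesis unfolding disjunctive_feasible_def by simp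
  qed
  then obtain u where u: "u \<in> disjunctive_feasible M w b \<K>"
    "span (w ` active_set M w b u) = span (w ` M)"
    "\<And>v. v \<in> disjunctive_feasible M w b \<K> \<Longrightarrow> c \<bullet> u \<le> c \<bullet> v"
    using best_vertex_exists[OF M rec c] by blast
  define A where "A = active_set M w b u"
  have A: "A \<subseteq> M" "finite A" "independent_family w A" "hits A \<K>" "span (w ` A) = span (w ` M)"
    using u(1,2) gen M unfolding A_def disjunctive_feasible_def by (auto simp: active_set_def)
  have "- c \<in> span (w ` A)" using c A(5) span_neg by auto
  then obtain \<mu> where mu: "- c = (\<Sum>i\<in>A. \<mu> i *\<^sub>R w i)"
    using independent_family_span_coefficients A(2,3) by blast
  \<comment> \<open>Along \<open>d\<close> only constraint \<open>j\<close> is released among those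
    in \<open>A\<close>, and pairing the multiplier equation with \<open>d\<close> gives
    \<open>\<mu> j = c \<bullet> d\<close>. Optimality of \<open>u\<close> makes this
    nonnegative.\<close>
  have "\<mu> j \<ge> 0" if j: "j \<in> A" "hits (A - {j}) \<K>" for j
  proof -
    have "w j \<notin> span (w ` (A - {j}))" using A(3) j(1) unfolding independent_family_iff by blast
    then obtain d where d: "\<And>y. y \<in> w ` (A - {j}) \<Longrightarrow> y \<bullet> d = 0" "w j \<bullet> d = - 1"
      by (rule not_in_span_separating_vector) blast
    have nonpos: "w i \<bullet> d \<le> 0" if "i \<in> A" for i
      using d that by (cases "i = j") auto
    obtain t where t: "t > 0" "\<And>i. i \<in> M \<Longrightarrow> w i \<bullet> (u + t *\<^sub>R d) \<le> b i"
    proof (rule feasible_ray_step[of M w u b d])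
      show "w i \<bullet> u \<le> b i" if "i \<in> M" for i
        using u(1) that unfolding disjunctive_feasible_def by auto
      show "w i \<bullet> d \<le> 0" if "i \<in> M" "w i \<bullet> u = b i" for i
        using nonpos that unfolding A_def active_set_def by auto
    qed (use M in blast)+
    have "A - {j} \<subseteq> active_set M w b (u + t *\<^sub>R d)"
      using d(1) unfolding A_def active_set_def by (auto simp: inner_add_right)
    then have "u + t *\<^sub>R d \<in> disjunctive_feasible M w b \<K>"
      using t(2) j(2) hits_mono unfolding disjunctive_feasible_def by blast
    then have "t * (c \<bullet> d) \<ge> 0" using u(3) by (force simp: inner_add_right)
    then have "c \<bullet> d \<ge> 0" using t(1) by (simp add: zero_le_mult_iff)
    moreover have "- (c \<bullet> d) = (\<Sum>i\<in>A. \<mu> i * (w i \<bullet> d))"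
      using arg_cong[OF mu, of "\<lambda>x. x \<bullet> d"] by (simp add: inner_sum_left)
    moreover have "(\<Sum>i\<in>A. \<mu> i * (w i \<bullet> d)) = - \<mu> j"
      using d A(2) j(1) by (simp add: sum.remove[of A j])
    ultimately show ?thesis by simp
  qed
  moreover have "c + (\<Sum>i\<in>A. \<mu> i *\<^sub>R w i) = 0" using mu by (metis add.right_inverse)
  ultimately show ?thesis using that A by blast
qed


section \<open>Gradients and the stationarity equation\<close>

lemma inner_gradient_has_derivative:
  fixes \<phi> :: "real^'n \<Rightarrow> real"
  assumes "\<phi> differentiable (at x)"
  shows "(\<phi> has_derivative (\<lambda>h. gradient \<phi> x \<bullet> h)) (at x)"
proof -
  obtain f' where f': "(\<phi> has_derivative f') (at x)"
    using assms unfolding differentiable_def by blast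
  then have "linear f'" by (rule has_derivative_linear)
  \<comment> \<open>The adjoint evaluated at 1 is the Riesz representer of the functional
    \<open>f'\<close>; it supplies the existence needed for the description in
    \<open>gradient\<close>.\<close>
  then have "f' = (\<lambda>h. h \<bullet> adjoint f' 1)" using adjoint_works[of f' _ 1] by (auto simp: inner_commute)
  then have G: "GDERIV \<phi> x :> adjoint f' 1" using f' unfolding gderiv_def by metis
  have "GDERIV \<phi> x :> gradient \<phi> x"
    unfolding gradient_def
  proof (rule theI[of _ "adjoint f' 1"])
    show "D = adjoint f' 1" if "GDERIV \<phi> x :> D" for D
      using has_derivative_unique[OF that[unfolded gderiv_def] G[unfolded gderiv_def]]
      by (metis vector_eq_ldot)
  qed (rule G)
  then show ?thesis unfolding gderiv_def by (simp add: inner_commute)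
qed

lemma gradient_eqI:
  assumes "(\<phi> has_derivative (\<lambda>h. D \<bullet> h)) (at x)"
  shows "gradient \<phi> x = D"
proof -
  have "(\<lambda>h. gradient \<phi> x \<bullet> h) = (\<lambda>h. D \<bullet> h)"
    using assms differentiableI has_derivative_unique inner_gradient_has_derivative by blast
  then show ?thesis by (metis vector_eq_rdot)
qed

lemma gradient_Lagrangian:
  assumes "mpec_smooth P x"
  shows "gradient (\<lambda>y. Lagrangian P y 1 (\<mu>g, \<mu>h, \<mu>G, \<mu>H)) x =
    gradient (obj P) x + (\<Sum>i\<in>{1..dim_g P}. \<mu>g i *\<^sub>R gradient (con_g P i) x)
      + (\<Sum>i\<in>{1..dim_h P}. \<mu>h i *\<^sub>R gradient (con_h P i) x)
      - (\<Sum>i\<in>{1..dim_GH P}. \<mu>G i *\<^sub>R gradient (con_G P i) x)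
      - (\<Sum>i\<in>{1..dim_GH P}. \<mu>H i *\<^sub>R gradient (con_H P i) x)"
proof (rule gradient_eqI)
  have D: "(obj P has_derivative (\<lambda>h. gradient (obj P) x \<bullet> h)) (at x)"
    "\<And>i. i \<in> {1..dim_g P} \<Longrightarrow> (con_g P i has_derivative (\<lambda>h. gradient (con_g P i) x \<bullet> h)) (at x)"
    "\<And>i. i \<in> {1..dim_h P} \<Longrightarrow> (con_h P i has_derivative (\<lambda>h. gradient (con_h P i) x \<bullet> h)) (at x)"
    "\<And>i. i \<in> {1..dim_GH P} \<Longrightarrow> (con_G P i has_derivative (\<lambda>h. gradient (con_G P i) x \<bullet> h)) (at x)"
    "\<And>i. i \<in> {1..dim_GH P} \<Longrightarrow> (con_H P i has_derivative (\<lambda>h. gradient (con_H P i) x \<bullet> h)) (at x)"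
    using assms unfolding mpec_smooth_def C1_twice_differentiable_at_def
    by (blast intro: inner_gradient_has_derivative)+
  show "((\<lambda>y. Lagrangian P y 1 (\<mu>g, \<mu>h, \<mu>G, \<mu>H)) has_derivative
     (\<lambda>h. (gradient (obj P) x + (\<Sum>i\<in>{1..dim_g P}. \<mu>g i *\<^sub>R gradient (con_g P i) x)
      + (\<Sum>i\<in>{1..dim_h P}. \<mu>h i *\<^sub>R gradient (con_h P i) x)
      - (\<Sum>i\<in>{1..dim_GH P}. \<mu>G i *\<^sub>R gradient (con_G P i) x)
      - (\<Sum>i\<in>{1..dim_GH P}. \<mu>H i *\<^sub>R gradient (con_H P i) x)) \<bullet> h)) (at x)"
    unfolding Lagrangian_def split_conv mult_1_left
    by (rule derivative_eq_intros D refl | assumption)+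
      (simp add: inner_add_left inner_diff_left inner_sum_left)
qed

text \<open>In every constraint term either the multiplier or the directional derivative along
  \<open>u\<close> vanishes, so pairing the stationarity equation with \<open>u\<close> leaves only
  the objective.\<close>

lemma Lambda1_dir_inner_gradient_obj:
  assumes sm: "mpec_smooth P x" and fe: "feasible P x"
    and u: "u \<in> T_lin P x" and mu: "(\<mu>g, \<mu>h, \<mu>G, \<mu>H) \<in> Lambda1_dir P x u"
  shows "gradient (obj P) x \<bullet> u = 0"
proof -
  have mu': "\<And>i. i \<in> {1..dim_g P} \<Longrightarrow> \<mu>g i * con_g P i x = 0"
     "\<And>i. i \<in> I_g P x - I_g_dir P x u \<Longrightarrow> \<mu>g i = 0"
     "\<And>i. i \<in> I_zp P x \<union> I_zp_dir P x u \<Longrightarrow> \<mu>H i = 0"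
     "\<And>i. i \<in> I_pz P x \<union> I_pz_dir P x u \<Longrightarrow> \<mu>G i = 0"
    and L: "gradient (\<lambda>y. Lagrangian P y 1 (\<mu>g, \<mu>h, \<mu>G, \<mu>H)) x = 0"
    using mu unfolding Lambda1_dir_def by auto
  have cases: "i \<in> I_zp P x \<or> i \<in> I_pz P x \<or> i \<in> I_zz P x" if "i \<in> {1..dim_GH P}" for i
  proof -
    have "con_G P i x \<ge> 0" "con_H P i x \<ge> 0" "con_G P i x = 0 \<or> con_H P i x = 0"
      using fe that unfolding feasible_def by auto
    then show ?thesis using that unfolding I_zp_def I_pz_def I_zz_def by auto
  qed
  have Q: "gradient (con_G P i) x \<bullet> u = 0 \<or> i \<in> I_pz_dir P x u"
      "gradient (con_H P i) x \<bullet> u = 0 \<or> i \<in> I_zp_dir P x u" if "i \<in> I_zz P x" for i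
    using u that unfolding T_lin_def Q_EC_def I_pz_dir_def I_zp_dir_def by force+
  have g: "\<mu>g i * (gradient (con_g P i) x \<bullet> u) = 0" if "i \<in> {1..dim_g P}" for i
    using mu'(1,2)[of i] that unfolding I_g_dir_def I_g_def by auto
  have h: "gradient (con_h P i) x \<bullet> u = 0" if "i \<in> {1..dim_h P}" for i
    using u that unfolding T_lin_def by auto
  have G: "\<mu>G i * (gradient (con_G P i) x \<bullet> u) = 0" if "i \<in> {1..dim_GH P}" for i
    using cases[OF that] Q(1)[of i] mu'(4)[of i] u unfolding T_lin_def by auto
  have H: "\<mu>H i * (gradient (con_H P i) x \<bullet> u) = 0" if "i \<in> {1..dim_GH P}" for i
    using cases[OF that] Q(2)[of i] mu'(3)[of i] u unfolding T_lin_def by auto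
  have "gradient (obj P) x \<bullet> u + (\<Sum>i\<in>{1..dim_g P}. \<mu>g i * (gradient (con_g P i) x \<bullet> u))
      + (\<Sum>i\<in>{1..dim_h P}. \<mu>h i * (gradient (con_h P i) x \<bullet> u))
      - (\<Sum>i\<in>{1..dim_GH P}. \<mu>G i * (gradient (con_G P i) x \<bullet> u))
      - (\<Sum>i\<in>{1..dim_GH P}. \<mu>H i * (gradient (con_H P i) x \<bullet> u)) = 0"
    using arg_cong[OF L[unfolded gradient_Lagrangian[OF sm]], of "\<lambda>y. y \<bullet> u"]
    by (simp add: inner_add_left inner_diff_left inner_sum_left)
  moreover have "(\<Sum>i\<in>{1..dim_g P}. \<mu>g i * (gradient (con_g P i) x \<bullet> u)) = 0"
    "(\<Sum>i\<in>{1..dim_h P}. \<mu>h i * (gradient (con_h P i) x \<bullet> u)) = 0"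
    "(\<Sum>i\<in>{1..dim_GH P}. \<mu>G i * (gradient (con_G P i) x \<bullet> u)) = 0"
    "(\<Sum>i\<in>{1..dim_GH P}. \<mu>H i * (gradient (con_H P i) x \<bullet> u)) = 0"
    using g h G H by (intro sum.neutral; simp)+
  ultimately show ?thesis by simp
qed

section \<open>The linearised constraints as one family of upper bounds, with \<open>G\<close> and
  \<open>H\<close> negated\<close>

fun label_sign :: "label \<Rightarrow> real" where
  "label_sign (Lab_g i) = 1"
| "label_sign (Lab_h i) = 1"
| "label_sign (Lab_G i) = - 1"
| "label_sign (Lab_H i) = - 1"

lemma label_sign_nonzero: "label_sign k \<noteq> 0"
  by (cases k) auto

definition active_labels :: "'n::finite mpec \<Rightarrow> real^'n \<Rightarrow> label set" where
  "active_labels P x = labels P (I_g P x) (I_zp P x \<union> I_zz P x) (I_pz P x \<union> I_zz P x)"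

text \<open>The disjunctive structure of the linearised problem: each of these sets must contain
  an active constraint. Equality constraints are the singletons.\<close>

definition required_labels :: "'n::finite mpec \<Rightarrow> real^'n \<Rightarrow> label set set" where
  "required_labels P x =
     (\<lambda>i. {Lab_h i}) ` {1..dim_h P} \<union> (\<lambda>i. {Lab_G i}) ` I_zp P x \<union>
     (\<lambda>i. {Lab_H i}) ` I_pz P x \<union> (\<lambda>i. {Lab_G i, Lab_H i}) ` I_zz P x"

lemma hits_required_labels_iff:
  "hits A (required_labels P x) \<longleftrightarrow>
     (\<forall>i\<in>{1..dim_h P}. Lab_h i \<in> A) \<and> (\<forall>i\<in>I_zp P x. Lab_G i \<in> A) \<and>
     (\<forall>i\<in>I_pz P x. Lab_H i \<in> A) \<and> (\<forall>i\<in>I_zz P x. Lab_G i \<in> A \<or> Lab_H i \<in> A)"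
  unfolding hits_def required_labels_def by (simp add: ball_Un)

text \<open>A one-sided bound together with forced activity is an equality. For a biactive index
  both bounds hold and one of them is tight, which is membership in \<open>Q_EC\<close>.\<close>

lemma disjunctive_feasible_imp_T_lin:
  assumes "d \<in> disjunctive_feasible (active_labels P x)
    (\<lambda>k. label_sign k *\<^sub>R con_gradient P x k) (\<lambda>_. 0) (required_labels P x)"
  shows "d \<in> T_lin P x"
  using assms
  unfolding disjunctive_feasible_def hits_required_labels_iff active_set_def
    active_labels_def labels_def T_lin_def Q_EC_def
  by (auto simp: ball_Un)

lemma card_labels:
  assumes "finite Jg" "finite JG" "finite JH"
  shows "card (labels P Jg JG JH) = card Jg + dim_h P + card JG + card JH"
  unfolding labels_def using assms
  by (subst card_Un_disjoint; (auto simp: card_image inj_on_def)[1])+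

lemma sum_labels:
  assumes "finite Jg" "finite JG" "finite JH"
  shows "sum f (labels P Jg JG JH) =
    (\<Sum>i\<in>Jg. f (Lab_g i)) + (\<Sum>i\<in>{1..dim_h P}. f (Lab_h i)) +
    (\<Sum>i\<in>JG. f (Lab_G i)) + (\<Sum>i\<in>JH. f (Lab_H i))"
  unfolding labels_def using assms
  by (subst sum.union_disjoint; (auto simp: sum.reindex inj_on_def)[1])+

section \<open>Strong M-stationarity from an optimal basis\<close>

theorem theorem4p3:
  fixes P :: "'n::finite mpec" and xb :: "real^'n"
  assumes "mpec_smooth P xb"
    and "feasible P xb"
    and "extended_M_stationary P xb"
    and "\<exists>Jg JG JH. mpec_working_set P xb Jg JG JH"
  shows "strongly_M_stationary P xb"
proof -
  define w where "w = (\<lambda>k. label_sign k *\<^sub>R con_gradient P xb k)"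
  define M where "M = active_labels P xb"
  let ?c = "gradient (obj P) xb" and ?K = "required_labels P xb"
  have fin: "finite (I_g P xb)" "finite (I_zp P xb)" "finite (I_pz P xb)" "finite (I_zz P xb)"
    unfolding I_g_def I_zp_def I_pz_def I_zz_def by auto
  have finM: "finite M" unfolding M_def active_labels_def labels_def using fin by auto
  have part: "I_zp P xb \<union> I_pz P xb \<union> I_zz P xb = {1..dim_GH P}"
    "I_zp P xb \<inter> I_pz P xb = {}" "I_zp P xb \<inter> I_zz P xb = {}" "I_pz P xb \<inter> I_zz P xb = {}"
    using assms(2) unfolding feasible_def I_zp_def I_pz_def I_zz_def by force+
  have rec: "?c \<bullet> d \<ge> 0" if "d \<in> disjunctive_feasible M w (\<lambda>_. 0) ?K" for d
  proof (rule ccontr)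
    assume neg: "\<not> ?c \<bullet> d \<ge> 0"
    have T: "d \<in> T_lin P xb"
      using that disjunctive_feasible_imp_T_lin unfolding M_def w_def by blast
    then have "Lambda1_dir P xb d \<noteq> {}"
      using assms(3) neg unfolding extended_M_stationary_def critical_cone_def by simp
    then obtain \<mu>g \<mu>h \<mu>G \<mu>H where "(\<mu>g, \<mu>h, \<mu>G, \<mu>H) \<in> Lambda1_dir P xb d"
      by (metis all_not_in_conv prod_cases4)
    then have "?c \<bullet> d = 0" using Lambda1_dir_inner_gradient_obj assms(1,2) T by blast
    then show False using neg by simp
  qed
  obtain Ig IG IH where I: "mpec_working_set P xb Ig IG IH" using assms(4) by blast
  define J where "J = labels P Ig IG IH"
  have J: "J \<subseteq> M" "independent_family w J" "hits J ?K"
  proof -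
    show "J \<subseteq> M" using I unfolding mpec_working_set_def J_def M_def active_labels_def labels_def
      by auto
    show "independent_family w J"
      using I label_sign_nonzero unfolding w_def mpec_working_set_def J_def
      by (simp add: independent_family_scaleR)
    have sub: "IG \<subseteq> I_zp P xb \<union> I_zz P xb" "IH \<subseteq> I_pz P xb \<union> I_zz P xb"
      "IG \<union> IH = {1..dim_GH P}"
      using I unfolding mpec_working_set_def by auto
    \<comment> \<open>An index in \<open>I_zp\<close> cannot belong to \<open>IH\<close>, so the
      covering condition of the working set places it in \<open>IG\<close>; the case of
      \<open>I_pz\<close> is symmetric.\<close>
    have "I_zp P xb \<subseteq> IG" "I_pz P xb \<subseteq> IH" "I_zz P xb \<subseteq> IG \<union> IH"
      using sub part by blast+
    then show "hits J ?K"
      unfolding hits_required_labels_iff J_def labels_def by blast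
  qed
  obtain A \<mu> where A: "A \<subseteq> M" "independent_family w A" "hits A ?K" "span (w ` A) = span (w ` M)"
    and mu: "?c + (\<Sum>k\<in>A. \<mu> k *\<^sub>R w k) = 0" "\<And>k. k \<in> A \<Longrightarrow> hits (A - {k}) ?K \<Longrightarrow> \<mu> k \<ge> 0"
    using nondegenerate_optimal_basis[of M w ?K ?c J] finM rec J by blast
  define Jg JG JH where "Jg = {i. Lab_g i \<in> A}" and "JG = {i. Lab_G i \<in> A}"
    and "JH = {i. Lab_H i \<in> A}"
  have sub: "Jg \<subseteq> I_g P xb" "JG \<subseteq> I_zp P xb \<union> I_zz P xb" "JH \<subseteq> I_pz P xb \<union> I_zz P xb"
    using A(1) unfolding Jg_def JG_def JH_def M_def active_labels_def labels_def by auto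
  have hA: "\<And>i. i \<in> {1..dim_h P} \<Longrightarrow> Lab_h i \<in> A" "I_zp P xb \<subseteq> JG" "I_pz P xb \<subseteq> JH"
    "I_zz P xb \<subseteq> JG \<union> JH"
    using A(3) unfolding hits_required_labels_iff JG_def JH_def by auto
  have finJ: "finite Jg" "finite JG" "finite JH" using sub fin by (meson finite_UnI finite_subset)+
  have A_eq: "A = labels P Jg JG JH"
  proof (intro set_eqI iffI)
    fix k assume k: "k \<in> A"
    then have "k \<in> M" using A(1) by blast
    then show "k \<in> labels P Jg JG JH"
      using k unfolding M_def active_labels_def labels_def Jg_def JG_def JH_def by auto
  next
    fix k assume "k \<in> labels P Jg JG JH"
    then show "k \<in> A" using hA(1) unfolding labels_def Jg_def JG_def JH_def by auto
  qed
  have cover: "JG \<union> JH = {1..dim_GH P}" using sub hA part by blast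
  have ind: "independent_family (con_gradient P xb) A"
    using A(2) label_sign_nonzero unfolding w_def by (simp add: independent_family_scaleR)
  have span_w: "span (w ` S) = span (con_gradient P xb ` S)" for S
    unfolding w_def by (rule span_image_scaleR) (rule label_sign_nonzero)
  \<comment> \<open>Independence turns the cardinality into a dimension, and spanning turns that
    dimension into the rank of all active gradients.\<close>
  have "card A = dim (con_gradient P xb ` A)"
    using ind unfolding independent_family_def by (simp add: dim_eq_card_independent card_image)
  also have "\<dots> = mpec_rank P xb"
    using A(4) unfolding span_w mpec_rank_def M_def active_labels_def by (metis dim_span)
  finally have "card Jg + dim_h P + card JG + card JH = mpec_rank P xb"
    unfolding A_eq using card_labels finJ by metis
  then have ws: "mpec_working_set P xb Jg JG JH"
    using sub cover ind unfolding mpec_working_set_def A_eq by simp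
  \<comment> \<open>Extension by zero makes the multipliers vanish off the new working set.\<close>
  define \<nu> where "\<nu> k = (if k \<in> A then \<mu> k else 0)" for k
  define \<mu>g \<mu>h \<mu>G \<mu>H where "\<mu>g i = \<nu> (Lab_g i)" and "\<mu>h i = \<nu> (Lab_h i)"
    and "\<mu>G i = \<nu> (Lab_G i)" and "\<mu>H i = \<nu> (Lab_H i)" for i
  have zero: "\<And>i. i \<notin> Jg \<Longrightarrow> \<mu>g i = 0" "\<And>i. i \<notin> {1..dim_h P} \<Longrightarrow> \<mu>h i = 0"
    "\<And>i. i \<notin> JG \<Longrightarrow> \<mu>G i = 0" "\<And>i. i \<notin> JH \<Longrightarrow> \<mu>H i = 0"
    unfolding \<mu>g_def \<mu>h_def \<mu>G_def \<mu>H_def \<nu>_def A_eq labels_def by auto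
  have range: "Jg \<subseteq> {1..dim_g P}" "JG \<subseteq> {1..dim_GH P}" "JH \<subseteq> {1..dim_GH P}"
    using sub(1) cover unfolding I_g_def by auto
  have pos_g: "\<mu>g i \<ge> 0" for i
  proof -
    \<comment> \<open>No required set contains a \<open>Lab_g\<close> label, so an inequality
      constraint can always be released.\<close>
    have "hits (A - {Lab_g i}) ?K" using A(3) unfolding hits_required_labels_iff by simp
    then show ?thesis using mu(2) unfolding \<mu>g_def \<nu>_def by simp
  qed
  have pos_GH: "\<mu>G i \<ge> 0" "\<mu>H i \<ge> 0" if i: "i \<in> JG \<inter> JH" for i
  proof -
    \<comment> \<open>An index in both sets is biactive: releasing one of its two constraints leaves
      the other to satisfy the disjunction.\<close>
    have "i \<in> I_zz P xb" using i sub part by blast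
    then have "i \<notin> I_zp P xb" "i \<notin> I_pz P xb" using part by auto
    moreover have "Lab_G i \<in> A" "Lab_H i \<in> A" using i unfolding JG_def JH_def by auto
    ultimately have "hits (A - {Lab_G i}) ?K" "hits (A - {Lab_H i}) ?K"
      using A(3) unfolding hits_required_labels_iff by auto
    then show "\<mu>G i \<ge> 0" "\<mu>H i \<ge> 0" using mu(2) unfolding \<mu>G_def \<mu>H_def \<nu>_def by auto
  qed
  have "(\<Sum>k\<in>A. \<mu> k *\<^sub>R w k) = (\<Sum>k\<in>A. \<nu> k *\<^sub>R w k)" unfolding \<nu>_def by simp
  also have "\<dots> = (\<Sum>i\<in>Jg. \<mu>g i *\<^sub>R gradient (con_g P i) xb)
      + (\<Sum>i\<in>{1..dim_h P}. \<mu>h i *\<^sub>R gradient (con_h P i) xb)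
      - (\<Sum>i\<in>JG. \<mu>G i *\<^sub>R gradient (con_G P i) xb)
      - (\<Sum>i\<in>JH. \<mu>H i *\<^sub>R gradient (con_H P i) xb)"
    unfolding A_eq sum_labels[OF finJ] w_def \<mu>g_def \<mu>h_def \<mu>G_def \<mu>H_def
    by (simp add: sum_negf)
  also have "(\<Sum>i\<in>Jg. \<mu>g i *\<^sub>R gradient (con_g P i) xb)
      = (\<Sum>i\<in>{1..dim_g P}. \<mu>g i *\<^sub>R gradient (con_g P i) xb)"
    by (rule sum.mono_neutral_left) (use range zero in auto)
  also have "(\<Sum>i\<in>JG. \<mu>G i *\<^sub>R gradient (con_G P i) xb)
      = (\<Sum>i\<in>{1..dim_GH P}. \<mu>G i *\<^sub>R gradient (con_G P i) xb)"
    by (rule sum.mono_neutral_left) (use range zero in auto)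
  also have "(\<Sum>i\<in>JH. \<mu>H i *\<^sub>R gradient (con_H P i) xb)
      = (\<Sum>i\<in>{1..dim_GH P}. \<mu>H i *\<^sub>R gradient (con_H P i) xb)"
    by (rule sum.mono_neutral_left) (use range zero in auto)
  finally have sum_eq: "(\<Sum>k\<in>A. \<mu> k *\<^sub>R w k) =
      (\<Sum>i\<in>{1..dim_g P}. \<mu>g i *\<^sub>R gradient (con_g P i) xb)
      + (\<Sum>i\<in>{1..dim_h P}. \<mu>h i *\<^sub>R gradient (con_h P i) xb)
      - (\<Sum>i\<in>{1..dim_GH P}. \<mu>G i *\<^sub>R gradient (con_G P i) xb)
      - (\<Sum>i\<in>{1..dim_GH P}. \<mu>H i *\<^sub>R gradient (con_H P i) xb)" .
  have grad: "gradient (\<lambda>y. Lagrangian P y 1 (\<mu>g, \<mu>h, \<mu>G, \<mu>H)) xb = 0"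
    using mu(1) unfolding gradient_Lagrangian[OF assms(1)] sum_eq by (simp only: add_diff_eq add.assoc)
  have "\<mu>g \<in> vecs (dim_g P)" "\<mu>h \<in> vecs (dim_h P)" "\<mu>G \<in> vecs (dim_GH P)" "\<mu>H \<in> vecs (dim_GH P)"
    using range zero unfolding vecs_def by blast+
  moreover have "\<mu>g i * con_g P i xb = 0" for i
    using zero(1)[of i] sub(1) unfolding I_g_def by auto
  moreover have "\<mu>H i = 0" if "i \<in> I_zp P xb" for i using that zero(4) sub(3) part by blast
  moreover have "\<mu>G i = 0" if "i \<in> I_pz P xb" for i using that zero(3) sub(2) part by blast
  \<comment> \<open>On \<open>JG \<inter> JH\<close> both multipliers are nonnegative, so they are
    both positive or have product zero; outside it at least one of them vanishes.\<close>
  moreover have "(\<mu>G i > 0 \<and> \<mu>H i > 0) \<or> \<mu>G i * \<mu>H i = 0" for i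
    using zero(3,4)[of i] pos_GH[of i] by (cases "i \<in> JG \<inter> JH") (auto simp: less_le)
  moreover have "I_g_dir P xb 0 = I_g P xb" "I_zp_dir P xb 0 = {}" "I_pz_dir P xb 0 = {}"
    unfolding I_g_dir_def I_zp_dir_def I_pz_dir_def by auto
  ultimately have "(\<mu>g, \<mu>h, \<mu>G, \<mu>H) \<in> Lambda1 P xb"
    using pos_g grad unfolding Lambda1_def Lambda1_dir_def by auto
  then show ?thesis
    using ws zero pos_GH unfolding strongly_M_stationary_def by blast
qed

end
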